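(* Consider the disjunctive constraint $\bigvee_{l\in\mathcal D}\big[\,g_k(\boldsymbol x)\le b_{l,k}\ \forall k\in\mathcal C_l,\ \boldsymbol x\in\mathcal X\,\big]$ and suppose that the constraint functions have additive bounds over $\mathcal X$ and that $\mathcal X\subset\mathbb R^n$ is a box defined by (finite) lower and upper bounds on all variables. Then the continuous relaxations of the $P$-split formulations form a hierarchy in the following sense, where relaxations are compared through their projections onto the $\boldsymbol x$-space. (i) The continuous relaxation of the $1$-split formulation has the same projection onto the $\boldsymbol x$-space as the continuous relaxation of the big-M formulation. (ii) Each additional split results in an as tight or tighter relaxation: if a $(P+1)$-split formulation is obtained from a $P$-split formulation by splitting one of its variable groups into two, then the projection of the continuous relaxation of the $(P+1)$-split formulation is contained in that of the $P$-split formulation. (iii) If all constraints are linear (all $h_{i,k}$ are affine), then for $P=n$ the continuous relaxation gives the convex hull: the projection onto the $\boldsymbol x$-space of the continuous relaxation of the $n$-split formulation (implemented with the minimal number of auxiliary variables) equals the convex hull of $\bigcup_{l\in\mathcal D}\{\boldsymbol x\in\mathcal X: g_k(\boldsymbol x)\le b_{l,k}\ \forall k\in\mathcal C_l\}$.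
   Context: Setting. $\mathcal X\subset\mathbb R^n$ is a convex compact set, $\mathcal D$ is a finite set of disjunct indices, $\mathcal C_l$ is the finite set of constraint indices in disjunct $l\in\mathcal D$, and $b_{l,k}\in\mathbb R$. Each $g_k(\boldsymbol x)=\sum_{i=1}^n h_{i,k}(x_i)$ with $h_{i,k}:\mathbb R\to\mathbb R$ convex; all $g_k$ are bounded on $\mathcal X$; each disjunct $\{\boldsymbol x\in\mathcal X: g_k(\boldsymbol x)\le b_{l,k}\ \forall k\in\mathcal C_l\}$ is non-empty. $P$-split formulation. Let $\mathcal I_1,\dots,\mathcal I_P$ be a partition of $\{1,\dots,n\}$ into $P$ pairwise disjoint non-empty sets (the variable groups). For $s\in\{1,\dots,P\}$, $l\in\mathcal D$, $k\in\mathcal C_l$ put $\underline{\alpha}^{l,k}_s=\min_{\boldsymbol x\in\mathcal X}\sum_{i\in\mathcal I_s}h_{i,k}(x_i)$ and $\bar\alpha^{l,k}_s=\max_{\boldsymbol x\in\mathcal X}\sum_{i\in\mathcal I_s}h_{i,k}(x_i)$. The $P$-split formulation has variables $\boldsymbol x\in\mathcal X$, $\alpha^{l,k}_s\in\mathbb R$, $\nu^{\alpha^{l,k}_s}_d\in\mathbb R$ ($d\in\mathcal D$), $\boldsymbol\lambda\in\{0,1\}^{|\mathcal D|}$ and constraints, for all $s\in\{1,\dots,P\}$, $l,d\in\mathcal D$, $k\in\mathcal C_l$: $$\alpha^{l,k}_s=\sum_{d'\in\mathcal D}\nu^{\alpha^{l,k}_s}_{d'},\quad \sum_{s'=1}^P\nu^{\alpha^{l,k}_{s'}}_l\le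 b_{l,k}\lambda_l,\quad \underline{\alpha}^{l,k}_s\lambda_d\le\nu^{\alpha^{l,k}_s}_d\le\bar\alpha^{l,k}_s\lambda_d,\quad \sum_{i\in\mathcal I_s}h_{i,k}(x_i)\le\alpha^{l,k}_s,\quad \sum_{l'\in\mathcal D}\lambda_{l'}=1.$$ Its continuous relaxation replaces $\boldsymbol\lambda\in\{0,1\}^{|\mathcal D|}$ by $\boldsymbol\lambda\in[0,1]^{|\mathcal D|}$. Big-M formulation. Variables $\boldsymbol x\in\mathcal X$, $\boldsymbol\lambda\in\{0,1\}^{|\mathcal D|}$ with $\sum_{l\in\mathcal D}\lambda_l=1$ and $\sum_{i=1}^n h_{i,k}(x_i)\le b_{l,k}+M^{l,k}(1-\lambda_l)$ for all $l\in\mathcal D$, $k\in\mathcal C_l$, where $M^{l,k}=\max_{\boldsymbol x\in\mathcal X}\sum_{i=1}^nh_{i,k}(x_i)-b_{l,k}$. Its continuous relaxation again uses $\boldsymbol\lambda\in[0,1]^{|\mathcal D|}$. Additive bounds. The bounds are additive over $\mathcal X$ if for every constraint function $g_k$ and all disjoint $\mathcal I,\mathcal I'\subset\{1,\dots,n\}$, $\min_{\boldsymbol x\in\mathcal X}\big(\sum_{i\in\mathcal I}h_{i,k}(x_i)+\sum_{i\in\mathcal I'}h_{i,k}(x_i)\big)=\min_{\boldsymbol x\in\mathcal X}\sum_{i\in\mathcal I}h_{i,k}(x_i)+\min_{\boldsymbol x\in\mathcal X}\sum_{i\in\mathcal I'}h_{i,k}(x_i)$, and the same identity holds with $\max$ in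 place of $\min$. $n$-split formulation with minimal number of auxiliary variables (affine case). $P$-split formulations are implemented with as few auxiliary variables as possible: if the same or a scaled partial sum occurs in several constraints or disjuncts, a single auxiliary variable is used for it, and for affine partial sums the defining inequality is an equality. Thus, if $h_{i,k}(x_i)=a_{i,k}x_i+c_{i,k}$ for all $i,k$, the $n$-split formulation uses one auxiliary variable $\alpha_i=\gamma_ix_i$ per coordinate $i$ (with a fixed $\gamma_i\neq0$), bounds $\underline\alpha_i=\min_{\boldsymbol x\in\mathcal X}\gamma_ix_i$, $\bar\alpha_i=\max_{\boldsymbol x\in\mathcal X}\gamma_ix_i$, and consists of: $\boldsymbol x\in\mathcal X$, $\alpha_i=\gamma_ix_i$, $\alpha_i=\sum_{d\in\mathcal D}\nu_{i,d}$, $\underline\alpha_i\lambda_d\le\nu_{i,d}\le\bar\alpha_i\lambda_d$ for all $i\in\{1,\dots,n\}$, $d\in\mathcal D$; $\sum_{i=1}^n\frac{a_{i,k}}{\gamma_i}\nu_{i,d}\le\big(b_{d,k}-\sum_{i=1}^nc_{i,k}\big)\lambda_d$ for all $d\in\mathcal D$, $k\in\mathcal C_d$; $\sum_{d\in\mathcal D}\lambda_d=1$, $\boldsymbol\lambda\in\{0,1\}^{|\mathcal D|}$. *)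

theory Defs
  imports "HOL-Analysis.Analysis"
begin

text \<open>
  The coordinates of \<open>x\<close> are indexed by the finite type \<open>'n\<close>, so \<open>n = CARD('n)\<close>. Disjuncts are
  indexed by a set \<open>D :: 'd set\<close>, and \<open>C l :: 'k set\<close> holds the indices of the constraints of
  disjunct \<open>l\<close>. An index \<open>k\<close> may occur in several disjuncts; the function is then shared, while
  the right-hand side \<open>b l k\<close> depends on the disjunct.
\<close>

definition partial_sum :: "('n::finite \<Rightarrow> 'k \<Rightarrow> real \<Rightarrow> real) \<Rightarrow> 'k \<Rightarrow> 'n set \<Rightarrow> real ^ 'n \<Rightarrow> real"
  where "partial_sum h k S x = (\<Sum>i\<in>S. h i k (x $ i))"

abbreviation constraint_fun :: "('n::finite \<Rightarrow> 'k \<Rightarrow> real \<Rightarrow> real) \<Rightarrow> 'k \<Rightarrow> real ^ 'n \<Rightarrow> real"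
  where "constraint_fun h k \<equiv> partial_sum h k UNIV"

text \<open>
  The minimum and maximum below are attained values. They are meaningful for continuous functions
  on nonempty compact sets, which covers every use here, since a convex function on the whole
  real line is continuous.
\<close>

definition min_over :: "'a set \<Rightarrow> ('a \<Rightarrow> real) \<Rightarrow> real"
  where "min_over X f = (LEAST m. m \<in> f ` X)"

definition max_over :: "'a set \<Rightarrow> ('a \<Rightarrow> real) \<Rightarrow> real"
  where "max_over X f = (GREATEST m. m \<in> f ` X)"

definition disjunct ::
  "(real ^ 'n) set \<Rightarrow> ('d \<Rightarrow> 'k set) \<Rightarrow> ('n::finite \<Rightarrow> 'k \<Rightarrow> real \<Rightarrow> real) \<Rightarrow> ('d \<Rightarrow> 'k \<Rightarrow> real) \<Rightarrow> 'd
    \<Rightarrow> (real ^ 'n) set"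
  where "disjunct X C h b l = {x \<in> X. \<forall>k\<in>C l. constraint_fun h k x \<le> b l k}"

definition additive_bounds ::
  "(real ^ 'n) set \<Rightarrow> 'k set \<Rightarrow> ('n::finite \<Rightarrow> 'k \<Rightarrow> real \<Rightarrow> real) \<Rightarrow> bool"
  where "additive_bounds X K h \<longleftrightarrow>
    (\<forall>k\<in>K. \<forall>S T. S \<inter> T = {} \<longrightarrow>
       min_over X (\<lambda>x. partial_sum h k S x + partial_sum h k T x)
         = min_over X (partial_sum h k S) + min_over X (partial_sum h k T) \<and>
       max_over X (\<lambda>x. partial_sum h k S x + partial_sum h k T x)
         = max_over X (partial_sum h k S) + max_over X (partial_sum h k T))"

definition variable_partition :: "nat \<Rightarrow> (nat \<Rightarrow> 'n set) \<Rightarrow> bool"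
  where "variable_partition P I \<longleftrightarrow>
    (\<forall>s\<in>{1..P}. I s \<noteq> {}) \<and> disjoint_family_on I {1..P} \<and> (\<Union>s\<in>{1..P}. I s) = UNIV"

text \<open>
  The groups are compared as a family of sets, so that the groups of the finer partition may be
  numbered in any order.
\<close>

definition splits_one_group :: "nat \<Rightarrow> (nat \<Rightarrow> 'n set) \<Rightarrow> (nat \<Rightarrow> 'n set) \<Rightarrow> bool"
  where "splits_one_group P I J \<longleftrightarrow>
    (\<exists>s\<in>{1..P}. \<exists>A B. A \<noteq> {} \<and> B \<noteq> {} \<and> A \<inter> B = {} \<and> A \<union> B = I s \<and>
       J ` {1..P + 1} = I ` ({1..P} - {s}) \<union> {A, B})"

text \<open>
  In each formulation, \<open>\<Lambda>\<close> is the range of the components of \<open>lam\<close>: the value \<open>{0, 1}\<close> gives the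
  mixed-integer formulation and \<open>{0..1}\<close> its continuous relaxation. The first component of a
  feasible point is \<open>x\<close>, so the projection onto the \<open>x\<close>-space is the image under \<open>fst\<close>.
  Auxiliary variables are total functions whose values outside the index sets are unconstrained.
  In \<open>p_split\<close>, \<open>\<alpha> l k s\<close> is the auxiliary variable for group \<open>s\<close> of constraint \<open>k\<close> in disjunct \<open>l\<close>,
  and \<open>\<nu> l k s d\<close> is its disaggregated copy for disjunct \<open>d\<close>.
\<close>

definition p_split ::
  "real set \<Rightarrow> (real ^ 'n) set \<Rightarrow> 'd set \<Rightarrow> ('d \<Rightarrow> 'k set) \<Rightarrow> ('n::finite \<Rightarrow> 'k \<Rightarrow> real \<Rightarrow> real)
    \<Rightarrow> ('d \<Rightarrow> 'k \<Rightarrow> real) \<Rightarrow> nat \<Rightarrow> (nat \<Rightarrow> 'n set)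
    \<Rightarrow> ((real ^ 'n) \<times> ('d \<Rightarrow> 'k \<Rightarrow> nat \<Rightarrow> real) \<times> ('d \<Rightarrow> 'k \<Rightarrow> nat \<Rightarrow> 'd \<Rightarrow> real) \<times> ('d \<Rightarrow> real)) set"
  where "p_split \<Lambda> X D C h b P I =
    {(x, \<alpha>, \<nu>, lam). x \<in> X \<and> (\<forall>d\<in>D. lam d \<in> \<Lambda>) \<and> (\<Sum>d\<in>D. lam d) = 1 \<and>
       (\<forall>l\<in>D. \<forall>k\<in>C l.
          (\<Sum>s\<in>{1..P}. \<nu> l k s l) \<le> b l k * lam l \<and>
          (\<forall>s\<in>{1..P}.
             \<alpha> l k s = (\<Sum>d\<in>D. \<nu> l k s d) \<and>
             partial_sum h k (I s) x \<le> \<alpha> l k s \<and>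
             (\<forall>d\<in>D. min_over X (partial_sum h k (I s)) * lam d \<le> \<nu> l k s d \<and>
                     \<nu> l k s d \<le> max_over X (partial_sum h k (I s)) * lam d)))}"

definition big_M ::
  "real set \<Rightarrow> (real ^ 'n) set \<Rightarrow> 'd set \<Rightarrow> ('d \<Rightarrow> 'k set) \<Rightarrow> ('n::finite \<Rightarrow> 'k \<Rightarrow> real \<Rightarrow> real)
    \<Rightarrow> ('d \<Rightarrow> 'k \<Rightarrow> real) \<Rightarrow> ((real ^ 'n) \<times> ('d \<Rightarrow> real)) set"
  where "big_M \<Lambda> X D C h b =
    {(x, lam). x \<in> X \<and> (\<forall>d\<in>D. lam d \<in> \<Lambda>) \<and> (\<Sum>d\<in>D. lam d) = 1 \<and>
       (\<forall>l\<in>D. \<forall>k\<in>C l.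
          constraint_fun h k x
            \<le> b l k + (max_over X (constraint_fun h k) - b l k) * (1 - lam l))}"

text \<open>
  The \<open>n\<close>-split formulation with as few auxiliary variables as possible, for
  \<open>h i k t = a i k * t + c i k\<close>: a single auxiliary variable \<open>\<alpha> $ i = \<gamma> i * x $ i\<close> per coordinate
  serves all constraints of all disjuncts.
\<close>

definition n_split_affine ::
  "real set \<Rightarrow> (real ^ 'n) set \<Rightarrow> 'd set \<Rightarrow> ('d \<Rightarrow> 'k set) \<Rightarrow> ('n::finite \<Rightarrow> 'k \<Rightarrow> real)
    \<Rightarrow> ('n \<Rightarrow> 'k \<Rightarrow> real) \<Rightarrow> ('d \<Rightarrow> 'k \<Rightarrow> real) \<Rightarrow> ('n \<Rightarrow> real)
    \<Rightarrow> ((real ^ 'n) \<times> (real ^ 'n) \<times> ('n \<Rightarrow> 'd \<Rightarrow> real) \<times> ('d \<Rightarrow> real)) set"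
  where "n_split_affine \<Lambda> X D C a c b \<gamma> =
    {(x, \<alpha>, \<nu>, lam). x \<in> X \<and> (\<forall>d\<in>D. lam d \<in> \<Lambda>) \<and> (\<Sum>d\<in>D. lam d) = 1 \<and>
       (\<forall>i. \<alpha> $ i = \<gamma> i * x $ i \<and> \<alpha> $ i = (\<Sum>d\<in>D. \<nu> i d) \<and>
          (\<forall>d\<in>D. min_over X (\<lambda>y. \<gamma> i * y $ i) * lam d \<le> \<nu> i d \<and>
                  \<nu> i d \<le> max_over X (\<lambda>y. \<gamma> i * y $ i) * lam d)) \<and>
       (\<forall>d\<in>D. \<forall>k\<in>C d.
          (\<Sum>i\<in>UNIV. a i k / \<gamma> i * \<nu> i d) \<le> (b d k - (\<Sum>i\<in>UNIV. c i k)) * lam d)}"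

end

theory Submission imports Defs begin

text \<open>
  In every relaxation the auxiliary variables can be projected out by an explicit choice or by an
  explicit recombination of their values, and the three claims say which choice that is.

  For one group, the best values of \<open>\<nu>\<close> for a constraint with right-hand side \<open>b\<close> and range
  \<open>[m, M]\<close> are the largest ones allowed: \<open>min b M * lam l\<close> in the own disjunct \<open>l\<close> and
  \<open>M * lam d\<close> in all others. Their sum turns \<open>g x \<le> \<alpha>\<close> into the big-M inequality
  \<open>g x \<le> b * lam l + M * (1 - lam l)\<close> (\<open>p_split_1_eq_big_M\<close>).

  If a partition \<open>J\<close> refines a partition \<open>I\<close>, summing the variables of the \<open>J\<close>-groups inside each
  \<open>I\<close>-group sends feasible points to feasible points. Only the bounds on \<open>\<nu>\<close> could fail to add up,
  and additivity is exactly what makes them do so (\<open>p_split_refine\<close>). Splitting a single group is a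
  special case.

  In the affine \<open>n\<close>-split formulation, the substitution \<open>\<nu> i d = \<gamma> i * lam d * y d $ i\<close> replaces the
  disaggregated variables by points \<open>y d\<close>. The bounds on \<open>\<nu>\<close> say that \<open>y d\<close> lies in the box, because
  a box is determined by the ranges of its coordinates; the aggregated constraints say that \<open>y d\<close>
  satisfies the constraints of disjunct \<open>d\<close>; and \<open>\<alpha> $ i = \<gamma> i * x $ i\<close> says that
  \<open>x = (\<Sum>d\<in>D. lam d *\<^sub>R y d)\<close>. So the projection consists of the convex combinations of one point per
  disjunct, which is the convex hull of the union since the disjuncts are convex and nonempty
  (\<open>n_split_affine_eq_hull\<close>).
\<close>

section \<open>Attained bounds\<close>

lemma
  fixes f :: "'a::topological_space \<Rightarrow> real"
  assumes "compact X" "X \<noteq> {}" "continuous_on X f"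
  shows min_over_attained: "\<exists>p\<in>X. min_over X f = f p"
    and min_over_le: "x \<in> X \<Longrightarrow> min_over X f \<le> f x"
proof -
  obtain p where p: "p \<in> X" "\<And>x. x \<in> X \<Longrightarrow> f p \<le> f x"
    using continuous_attains_inf[OF assms] by blast
  have eq: "min_over X f = f p"
    unfolding min_over_def by (rule Least_equality) (use p in auto)
  show "\<exists>p\<in>X. min_over X f = f p"
    using p(1) eq by blast
  show "min_over X f \<le> f x" if "x \<in> X"
    using p(2)[OF that] eq by simp
qed

lemma
  fixes f :: "'a::topological_space \<Rightarrow> real"
  assumes "compact X" "X \<noteq> {}" "continuous_on X f"
  shows max_over_attained: "\<exists>p\<in>X. max_over X f = f p"
    and le_max_over: "x \<in> X \<Longrightarrow> f x \<le> max_over X f"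
proof -
  obtain p where p: "p \<in> X" "\<And>x. x \<in> X \<Longrightarrow> f x \<le> f p"
    using continuous_attains_sup[OF assms] by blast
  have eq: "max_over X f = f p"
    unfolding max_over_def by (rule Greatest_equality) (use p in auto)
  show "\<exists>p\<in>X. max_over X f = f p"
    using p(1) eq by blast
  show "f x \<le> max_over X f" if "x \<in> X"
    using p(2)[OF that] eq by simp
qed

lemma continuous_on_partial_sum:
  assumes "\<And>i. convex_on UNIV (h i k)"
  shows "continuous_on X (partial_sum h k S)"
proof -
  have h: "continuous_on UNIV (h i k)" for i
    using convex_on_continuous[OF open_UNIV] assms by blast
  show ?thesis
    unfolding partial_sum_def
    by (intro continuous_on_sum continuous_on_compose2[OF h] continuous_intros) auto
qed

section \<open>Projecting out the auxiliary variables\<close>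

text \<open>
  The variables \<open>\<alpha>\<close> are determined by \<open>\<nu>\<close>, so only \<open>\<nu>\<close> and the multipliers have to be supplied or
  transformed.
\<close>

lemma mem_fst_p_split_iff:
  "x \<in> fst ` p_split \<Lambda> X D C h b P I \<longleftrightarrow>
    x \<in> X \<and> (\<exists>\<nu> lam. (\<forall>d\<in>D. lam d \<in> \<Lambda>) \<and> (\<Sum>d\<in>D. lam d) = 1 \<and>
      (\<forall>l\<in>D. \<forall>k\<in>C l.
        (\<Sum>s\<in>{1..P}. \<nu> l k s l) \<le> b l k * lam l \<and>
        (\<forall>s\<in>{1..P}. partial_sum h k (I s) x \<le> (\<Sum>d\<in>D. \<nu> l k s d) \<and>
           (\<forall>d\<in>D. min_over X (partial_sum h k (I s)) * lam d \<le> \<nu> l k s d \<and>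
                   \<nu> l k s d \<le> max_over X (partial_sum h k (I s)) * lam d))))"
  (is "_ \<longleftrightarrow> _ \<and> (\<exists>\<nu> lam. ?F \<nu> lam)")
proof
  assume "x \<in> fst ` p_split \<Lambda> X D C h b P I"
  then obtain \<alpha> \<nu> lam where "(x, \<alpha>, \<nu>, lam) \<in> p_split \<Lambda> X D C h b P I"
    by auto
  then have "x \<in> X" "?F \<nu> lam"
    by (simp_all add: p_split_def) (metis (no_types, lifting))
  then show "x \<in> X \<and> (\<exists>\<nu> lam. ?F \<nu> lam)"
    by blast
next
  assume "x \<in> X \<and> (\<exists>\<nu> lam. ?F \<nu> lam)"
  then obtain \<nu> lam where "x \<in> X" "?F \<nu> lam"
    by blast
  then have "(x, \<lambda>l k s. \<Sum>d\<in>D. \<nu> l k s d, \<nu>, lam) \<in> p_split \<Lambda> X D C h b P I"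
    by (simp add: p_split_def)
  then show "x \<in> fst ` p_split \<Lambda> X D C h b P I"
    by force
qed

section \<open>One group: the big-M relaxation\<close>

text \<open>
  Summing the upper bounds on \<open>\<nu>\<close> gives the big-M inequality. Conversely, the largest admissible \<open>\<nu>\<close>
  works: it respects the lower bound in the own disjunct because a nonempty disjunct forces
  \<open>min g \<le> b\<close>, and capping \<open>b\<close> at \<open>max g\<close> covers constraints that are redundant on \<open>X\<close>.
\<close>

lemma p_split_1_eq_big_M:
  fixes X :: "(real ^ 'n::finite) set"
  assumes "compact X" "finite D"
    and convex: "\<And>l k i. l \<in> D \<Longrightarrow> k \<in> C l \<Longrightarrow> convex_on UNIV (h i k)"
    and nonempty: "\<And>l. l \<in> D \<Longrightarrow> disjunct X C h b l \<noteq> {}"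
    and "variable_partition 1 I"
  shows "fst ` p_split {0..1} X D C h b 1 I = fst ` big_M {0..1} X D C h b"
proof -
  have I1: "I (Suc 0) = UNIV"
    using \<open>variable_partition 1 I\<close> by (auto simp: variable_partition_def)
  define m M where "m k = min_over X (constraint_fun h k)"
    and "M k = max_over X (constraint_fun h k)" for k
  have le_M: "constraint_fun h k x \<le> M k" and m_le_M: "m k \<le> M k" and m_le_b: "m k \<le> b l k"
    if "l \<in> D" "k \<in> C l" "x \<in> X" for l k x
  proof -
    have cont: "continuous_on X (constraint_fun h k)"
      by (rule continuous_on_partial_sum) (rule convex[OF that(1,2)])
    have "X \<noteq> {}"
      using that by blast
    have m: "m k \<le> constraint_fun h k y" if "y \<in> X" for y
      unfolding m_def by (rule min_over_le[OF \<open>compact X\<close> \<open>X \<noteq> {}\<close> cont that])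
    show M: "constraint_fun h k x \<le> M k"
      unfolding M_def by (rule le_max_over[OF \<open>compact X\<close> \<open>X \<noteq> {}\<close> cont \<open>x \<in> X\<close>])
    show "m k \<le> M k"
      using m[OF \<open>x \<in> X\<close>] M by simp
    obtain y where "y \<in> X" "constraint_fun h k y \<le> b l k"
      using nonempty[OF \<open>l \<in> D\<close>] \<open>k \<in> C l\<close> by (auto simp: disjunct_def)
    then show "m k \<le> b l k"
      using m[OF \<open>y \<in> X\<close>] by simp
  qed
  have split: "(\<Sum>d\<in>D. f d) = f l + (\<Sum>d\<in>D - {l}. f d)" if "l \<in> D" for l and f :: "'a \<Rightarrow> real"
    using \<open>finite D\<close> that by (simp add: sum.remove)
  show ?thesis
  proof (intro set_eqI iffI)
    fix x assume "x \<in> fst ` p_split {0..1} X D C h b 1 I"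
    then obtain \<nu> lam where x: "x \<in> X" and lam: "\<forall>d\<in>D. lam d \<in> {0..1}" "(\<Sum>d\<in>D. lam d) = 1"
      and \<nu>: "\<forall>l\<in>D. \<forall>k\<in>C l. \<nu> l k (Suc 0) l \<le> b l k * lam l \<and>
        constraint_fun h k x \<le> (\<Sum>d\<in>D. \<nu> l k (Suc 0) d) \<and>
        (\<forall>d\<in>D. m k * lam d \<le> \<nu> l k (Suc 0) d \<and> \<nu> l k (Suc 0) d \<le> M k * lam d)"
      unfolding mem_fst_p_split_iff by (auto simp: I1 m_def M_def)
    have "constraint_fun h k x \<le> b l k + (M k - b l k) * (1 - lam l)" if lk: "l \<in> D" "k \<in> C l" for l k
    proof -
      have "constraint_fun h k x \<le> (\<Sum>d\<in>D. \<nu> l k (Suc 0) d)"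
        using \<nu> lk by blast
      also have "\<dots> = \<nu> l k (Suc 0) l + (\<Sum>d\<in>D - {l}. \<nu> l k (Suc 0) d)"
        using \<open>l \<in> D\<close> by (rule split)
      also have "\<dots> \<le> b l k * lam l + (\<Sum>d\<in>D - {l}. M k * lam d)"
        using \<nu> lk by (intro add_mono sum_mono) auto
      also have "\<dots> = b l k * lam l + M k * (1 - lam l)"
        using split[OF \<open>l \<in> D\<close>, of lam] lam(2) by (simp flip: sum_distrib_left)
      finally show ?thesis
        by (simp add: algebra_simps)
    qed
    then have "(x, lam) \<in> big_M {0..1} X D C h b"
      using x lam by (auto simp: big_M_def M_def)
    then show "x \<in> fst ` big_M {0..1} X D C h b"
      by force
  next
    fix x assume "x \<in> fst ` big_M {0..1} X D C h b"
    then obtain lam where x: "x \<in> X" and lam: "\<forall>d\<in>D. lam d \<in> {0..1}" "(\<Sum>d\<in>D. lam d) = 1"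
      and big: "\<forall>l\<in>D. \<forall>k\<in>C l. constraint_fun h k x \<le> b l k + (M k - b l k) * (1 - lam l)"
      by (auto simp: big_M_def M_def)
    define \<nu> where "\<nu> l k s d = (if d = l then min (b l k) (M k) else M k) * lam d"
      for l k and s :: nat and d
    have "\<nu> l k (Suc 0) l \<le> b l k * lam l \<and> constraint_fun h k x \<le> (\<Sum>d\<in>D. \<nu> l k (Suc 0) d) \<and>
        (\<forall>d\<in>D. m k * lam d \<le> \<nu> l k (Suc 0) d \<and> \<nu> l k (Suc 0) d \<le> M k * lam d)"
      if lk: "l \<in> D" "k \<in> C l" for l k
    proof (intro conjI ballI)
      show "\<nu> l k (Suc 0) l \<le> b l k * lam l"
        using lam(1) lk by (auto simp: \<nu>_def intro!: mult_right_mono)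
      have "(\<Sum>d\<in>D. \<nu> l k (Suc 0) d) = min (b l k) (M k) * lam l + (\<Sum>d\<in>D - {l}. M k * lam d)"
        using split[OF \<open>l \<in> D\<close>, of "\<nu> l k (Suc 0)"] by (simp add: \<nu>_def)
      also have "\<dots> = min (b l k) (M k) * lam l + M k * (1 - lam l)"
        using split[OF \<open>l \<in> D\<close>, of lam] lam(2) by (simp flip: sum_distrib_left)
      finally have eq: "(\<Sum>d\<in>D. \<nu> l k (Suc 0) d) = min (b l k) (M k) * lam l + M k * (1 - lam l)" .
      show "constraint_fun h k x \<le> (\<Sum>d\<in>D. \<nu> l k (Suc 0) d)"
      proof (cases "b l k \<le> M k")
        case True
        moreover have "constraint_fun h k x \<le> b l k + (M k - b l k) * (1 - lam l)"
          using big lk by blast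
        ultimately show ?thesis
          using eq by (simp add: min_def algebra_simps)
      next
        case False
        then show ?thesis
          using le_M[OF lk x] eq by (simp add: min_def algebra_simps)
      qed
    next
      fix d assume "d \<in> D"
      then have "0 \<le> lam d"
        using lam(1) by auto
      then show "m k * lam d \<le> \<nu> l k (Suc 0) d" "\<nu> l k (Suc 0) d \<le> M k * lam d"
        using m_le_M[OF lk x] m_le_b[OF lk x] by (auto simp: \<nu>_def intro!: mult_right_mono)
    qed
    then show "x \<in> fst ` p_split {0..1} X D C h b 1 I"
      unfolding mem_fst_p_split_iff
      by (intro conjI x exI[of _ \<nu>] exI[of _ lam]) (use lam in \<open>auto simp: I1 m_def M_def\<close>)
  qed
qed

section \<open>Refining the partition\<close>

lemma partial_sum_UN:
  assumes "finite F" "disjoint_family_on J F"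
  shows "partial_sum h k (\<Union>j\<in>F. J j) x = (\<Sum>j\<in>F. partial_sum h k (J j) x)"
  unfolding partial_sum_def
  using assms by (intro sum.UNION_disjoint) (auto simp: disjoint_family_on_def)

text \<open>
  For the empty family, additivity with two empty sets gives \<open>z = z + z\<close> for the bound \<open>z\<close> of the
  zero function, hence \<open>z = 0\<close>.
\<close>

lemma additive_bounds_UN:
  assumes "additive_bounds X K h" "k \<in> K" "finite F" "disjoint_family_on J F"
  shows "min_over X (partial_sum h k (\<Union>j\<in>F. J j)) = (\<Sum>j\<in>F. min_over X (partial_sum h k (J j)))"
    and "max_over X (partial_sum h k (\<Union>j\<in>F. J j)) = (\<Sum>j\<in>F. max_over X (partial_sum h k (J j)))"
proof -
  have un: "(\<lambda>x. partial_sum h k S x + partial_sum h k T x) = partial_sum h k (S \<union> T)"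
    if "S \<inter> T = {}" for S T
    unfolding partial_sum_def using that by (simp add: sum.union_disjoint)
  have add:
    "min_over X (partial_sum h k (S \<union> T)) = min_over X (partial_sum h k S) + min_over X (partial_sum h k T)"
    "max_over X (partial_sum h k (S \<union> T)) = max_over X (partial_sum h k S) + max_over X (partial_sum h k T)"
    if "S \<inter> T = {}" for S T
    unfolding un[OF that, symmetric]
    using assms(1,2) that by (simp_all add: additive_bounds_def)
  have "min_over X (partial_sum h k (\<Union>j\<in>F. J j)) = (\<Sum>j\<in>F. min_over X (partial_sum h k (J j))) \<and>
      max_over X (partial_sum h k (\<Union>j\<in>F. J j)) = (\<Sum>j\<in>F. max_over X (partial_sum h k (J j)))"
    using assms(3,4)
  proof (induction F)
    case empty
    show ?case
      using add[of "{}" "{}"] by simp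
  next
    case (insert j F)
    then show ?case
      using add[of "J j" "\<Union>j\<in>F. J j"] by (simp add: disjoint_family_on_insert)
  qed
  then show "min_over X (partial_sum h k (\<Union>j\<in>F. J j)) = (\<Sum>j\<in>F. min_over X (partial_sum h k (J j)))"
    and "max_over X (partial_sum h k (\<Union>j\<in>F. J j)) = (\<Sum>j\<in>F. max_over X (partial_sum h k (J j)))"
    by auto
qed

text \<open>
  The groups of the finer partition are sorted by the coarser group that contains them, so all the
  constraints of the coarser formulation are sums of constraints of the finer one.
\<close>

lemma p_split_refine:
  assumes add: "additive_bounds X (\<Union>l\<in>D. C l) h"
    and I: "variable_partition P I" and J: "variable_partition Q J"
    and refine: "\<And>j. j \<in> {1..Q} \<Longrightarrow> \<exists>s\<in>{1..P}. J j \<subseteq> I s"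
  shows "fst ` p_split \<Lambda> X D C h b Q J \<subseteq> fst ` p_split \<Lambda> X D C h b P I"
proof
  define F where "F s = {j \<in> {1..Q}. J j \<subseteq> I s}" for s
  have F_subset: "F s \<subseteq> {1..Q}" for s
    by (auto simp: F_def)
  have finite_F [simp]: "finite (F s)" for s
    by (simp add: F_def)
  have disj_J: "disjoint_family_on J (F s)" for s
    using J by (intro disjoint_family_on_mono[OF F_subset]) (simp add: variable_partition_def)
  have I_disj: "I s \<inter> I t = {}" if "s \<in> {1..P}" "t \<in> {1..P}" "s \<noteq> t" for s t
    using I that by (simp add: variable_partition_def disjoint_family_on_def)
  \<comment> \<open>A nonempty group fits into at most one group of the coarser partition.\<close>
  have F_disj: "F s \<inter> F t = {}" if "s \<in> {1..P}" "t \<in> {1..P}" "s \<noteq> t" for s t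
  proof -
    have "J j \<noteq> {}" if "j \<in> {1..Q}" for j
      using J that by (auto simp: variable_partition_def)
    then show ?thesis
      using I_disj[OF that] unfolding F_def by blast
  qed
  have UN_F: "(\<Union>s\<in>{1..P}. F s) = {1..Q}"
    using refine by (auto simp: F_def)
  have I_eq: "I s = (\<Union>j\<in>F s. J j)" if s: "s \<in> {1..P}" for s
  proof
    show "I s \<subseteq> (\<Union>j\<in>F s. J j)"
    proof
      fix i assume i: "i \<in> I s"
      obtain j where j: "j \<in> {1..Q}" "i \<in> J j"
        using J unfolding variable_partition_def by blast
      then obtain t where t: "t \<in> {1..P}" "J j \<subseteq> I t"
        using refine by blast
      then have "t = s"
        using I_disj[OF t(1) s] i j by blast
      then show "i \<in> (\<Union>j\<in>F s. J j)"
        using j t by (auto simp: F_def)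
    qed
  qed (auto simp: F_def)
  fix x assume "x \<in> fst ` p_split \<Lambda> X D C h b Q J"
  then obtain \<nu> lam where x: "x \<in> X" and lam: "\<forall>d\<in>D. lam d \<in> \<Lambda>" "(\<Sum>d\<in>D. lam d) = 1"
    and \<nu>: "\<forall>l\<in>D. \<forall>k\<in>C l. (\<Sum>j\<in>{1..Q}. \<nu> l k j l) \<le> b l k * lam l \<and>
      (\<forall>j\<in>{1..Q}. partial_sum h k (J j) x \<le> (\<Sum>d\<in>D. \<nu> l k j d) \<and>
        (\<forall>d\<in>D. min_over X (partial_sum h k (J j)) * lam d \<le> \<nu> l k j d \<and>
           \<nu> l k j d \<le> max_over X (partial_sum h k (J j)) * lam d))"
    unfolding mem_fst_p_split_iff by blast
  define \<mu> where "\<mu> l k s d = (\<Sum>j\<in>F s. \<nu> l k j d)" for l k s d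
  have rhs: "(\<Sum>s\<in>{1..P}. \<mu> l k s l) \<le> b l k * lam l" if "l \<in> D" "k \<in> C l" for l k
  proof -
    have "(\<Sum>s\<in>{1..P}. \<mu> l k s l) = (\<Sum>j\<in>(\<Union>s\<in>{1..P}. F s). \<nu> l k j l)"
      unfolding \<mu>_def using F_disj by (intro sum.UNION_disjoint[symmetric]) auto
    then show ?thesis
      using \<nu> that UN_F by simp
  qed
  have sums: "partial_sum h k (I s) x \<le> (\<Sum>d\<in>D. \<mu> l k s d)"
    if "l \<in> D" "k \<in> C l" "s \<in> {1..P}" for l k s
  proof -
    have "partial_sum h k (I s) x = (\<Sum>j\<in>F s. partial_sum h k (J j) x)"
      unfolding I_eq[OF \<open>s \<in> {1..P}\<close>] by (rule partial_sum_UN[OF finite_F disj_J])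
    also have "\<dots> \<le> (\<Sum>j\<in>F s. \<Sum>d\<in>D. \<nu> l k j d)"
      using \<nu> that F_subset by (intro sum_mono) blast
    also have "\<dots> = (\<Sum>d\<in>D. \<mu> l k s d)"
      unfolding \<mu>_def by (rule sum.swap)
    finally show ?thesis .
  qed
  have lower: "min_over X (partial_sum h k (I s)) * lam d \<le> \<mu> l k s d"
    and upper: "\<mu> l k s d \<le> max_over X (partial_sum h k (I s)) * lam d"
    if "l \<in> D" "k \<in> C l" "s \<in> {1..P}" "d \<in> D" for l k s d
  proof -
    have k: "k \<in> (\<Union>l\<in>D. C l)"
      using that by blast
    have "min_over X (partial_sum h k (I s)) * lam d
        = (\<Sum>j\<in>F s. min_over X (partial_sum h k (J j)) * lam d)"
      unfolding I_eq[OF \<open>s \<in> {1..P}\<close>] additive_bounds_UN(1)[OF add k finite_F disj_J]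
      by (rule sum_distrib_right)
    also have "\<dots> \<le> \<mu> l k s d"
      unfolding \<mu>_def using \<nu> that F_subset by (intro sum_mono) blast
    finally show "min_over X (partial_sum h k (I s)) * lam d \<le> \<mu> l k s d" .
    have "\<mu> l k s d \<le> (\<Sum>j\<in>F s. max_over X (partial_sum h k (J j)) * lam d)"
      unfolding \<mu>_def using \<nu> that F_subset by (intro sum_mono) blast
    also have "\<dots> = max_over X (partial_sum h k (I s)) * lam d"
      unfolding I_eq[OF \<open>s \<in> {1..P}\<close>] additive_bounds_UN(2)[OF add k finite_F disj_J]
      by (rule sum_distrib_right[symmetric])
    finally show "\<mu> l k s d \<le> max_over X (partial_sum h k (I s)) * lam d" .
  qed
  show "x \<in> fst ` p_split \<Lambda> X D C h b P I"
    unfolding mem_fst_p_split_iff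
    by (intro conjI ballI x exI[of _ \<mu>] exI[of _ lam] lam(1)[rule_format] lam(2)
        rhs sums lower upper)
qed

lemma splits_one_group_refines:
  assumes "splits_one_group P I J" "j \<in> {1..P + 1}"
  shows "\<exists>s\<in>{1..P}. J j \<subseteq> I s"
proof -
  obtain s A B where s: "s \<in> {1..P}" "A \<union> B = I s"
    and J: "J ` {1..P + 1} = I ` ({1..P} - {s}) \<union> {A, B}"
    using assms(1) unfolding splits_one_group_def by (elim bexE exE conjE) (rule that)
  have "J j \<in> I ` ({1..P} - {s}) \<union> {A, B}"
    unfolding J[symmetric] using assms(2) by (rule imageI)
  then consider "J j \<in> I ` ({1..P} - {s})" | "J j = A \<or> J j = B"
    by blast
  then show ?thesis
  proof cases
    case 1
    then show ?thesis
      by blast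
  next
    case 2
    then have "J j \<subseteq> I s"
      unfolding s(2)[symmetric] by blast
    then show ?thesis
      using s(1) by (rule bexI)
  qed
qed

section \<open>Affine constraints and the convex hull\<close>

text \<open>
  A box is the product of its coordinate projections, so scaled coordinate bounds suffice to
  recognise its points; both signs of the scaling factor are covered because the extremes are
  attained inside the box.
\<close>

lemma mem_cbox_iff_scaled_bounds:
  fixes L U y :: "real ^ 'n::finite"
  assumes "cbox L U \<noteq> {}" "\<And>i. \<gamma> i \<noteq> 0"
  shows "y \<in> cbox L U \<longleftrightarrow>
    (\<forall>i. min_over (cbox L U) (\<lambda>y. \<gamma> i * y $ i) \<le> \<gamma> i * y $ i \<and>
         \<gamma> i * y $ i \<le> max_over (cbox L U) (\<lambda>y. \<gamma> i * y $ i))"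
    (is "_ \<longleftrightarrow> (\<forall>i. ?m i \<le> _ \<and> _ \<le> ?M i)")
proof -
  have cont: "continuous_on (cbox L U) (\<lambda>y. \<gamma> i * y $ i)" for i
    by (intro continuous_intros)
  have "L $ i \<le> y $ i \<and> y $ i \<le> U $ i" if y: "?m i \<le> \<gamma> i * y $ i" "\<gamma> i * y $ i \<le> ?M i" for i
  proof -
    obtain p where p: "p \<in> cbox L U" "?m i = \<gamma> i * p $ i"
      using min_over_attained[OF compact_cbox assms(1) cont] by blast
    obtain q where q: "q \<in> cbox L U" "?M i = \<gamma> i * q $ i"
      using max_over_attained[OF compact_cbox assms(1) cont] by blast
    have "p $ i \<le> y $ i \<and> y $ i \<le> q $ i \<or> q $ i \<le> y $ i \<and> y $ i \<le> p $ i"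
      using y p(2) q(2) assms(2)[of i] by (cases "\<gamma> i > 0") (auto simp: mult_le_cancel_left)
    moreover have "L $ i \<le> p $ i" "p $ i \<le> U $ i" "L $ i \<le> q $ i" "q $ i \<le> U $ i"
      using p(1) q(1) by (simp_all add: mem_box_cart)
    ultimately show ?thesis
      by linarith
  qed
  then have "y \<in> cbox L U" if "\<forall>i. ?m i \<le> \<gamma> i * y $ i \<and> \<gamma> i * y $ i \<le> ?M i"
    using that by (auto simp: mem_box_cart)
  moreover have "?m i \<le> \<gamma> i * y $ i" "\<gamma> i * y $ i \<le> ?M i" if "y \<in> cbox L U" for i
    using min_over_le[OF compact_cbox assms(1) cont that]
      le_max_over[OF compact_cbox assms(1) cont that] by auto
  ultimately show ?thesis
    by blast
qed

lemma convex_disjunct: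
  fixes X :: "(real ^ 'n::finite) set"
  assumes "convex X" and convex: "\<And>k i. k \<in> C l \<Longrightarrow> convex_on UNIV (h i k)"
  shows "convex (disjunct X C h b l)"
proof (rule convexI)
  fix x y and u v :: real
  assume x: "x \<in> disjunct X C h b l" and y: "y \<in> disjunct X C h b l"
    and uv: "0 \<le> u" "0 \<le> v" "u + v = 1"
  have "constraint_fun h k (u *\<^sub>R x + v *\<^sub>R y) \<le> b l k" if "k \<in> C l" for k
  proof -
    have "constraint_fun h k (u *\<^sub>R x + v *\<^sub>R y) \<le> (\<Sum>i\<in>UNIV. u * h i k (x $ i) + v * h i k (y $ i))"
      unfolding partial_sum_def
      using convex[OF that] uv by (intro sum_mono) (simp add: convex_on_def)
    also have "\<dots> = u * constraint_fun h k x + v * constraint_fun h k y"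
      by (simp add: partial_sum_def sum.distrib sum_distrib_left)
    also have "\<dots> \<le> b l k"
      using x y that uv by (intro convex_bound_le) (auto simp: disjunct_def)
    finally show ?thesis .
  qed
  then show "u *\<^sub>R x + v *\<^sub>R y \<in> disjunct X C h b l"
    using x y uv \<open>convex X\<close> by (auto simp: disjunct_def intro: convexD)
qed

text \<open>
  A point \<open>y d\<close> of disjunct \<open>d\<close> and the values \<open>\<nu> i d = \<gamma> i * lam d * y d $ i\<close> determine each other
  as long as \<open>lam d > 0\<close>. If \<open>lam d = 0\<close>, the bounds force \<open>\<nu> i d = 0\<close>, and any point of the nonempty
  disjunct may be taken for \<open>y d\<close>.
\<close>

lemma n_split_affine_eq_hull:
  fixes X :: "(real ^ 'n::finite) set"
  assumes "finite D" and X: "X = cbox L U"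
    and nonempty: "\<And>l. l \<in> D \<Longrightarrow> disjunct X C h b l \<noteq> {}"
    and affine: "\<And>l k i t. l \<in> D \<Longrightarrow> k \<in> C l \<Longrightarrow> h i k t = a i k * t + c i k"
    and \<gamma>: "\<And>i. \<gamma> i \<noteq> 0"
  shows "fst ` n_split_affine {0..1} X D C a c b \<gamma> = convex hull (\<Union>l\<in>D. disjunct X C h b l)"
proof -
  define m M where "m i = min_over X (\<lambda>y. \<gamma> i * y $ i)"
    and "M i = max_over X (\<lambda>y. \<gamma> i * y $ i)" for i
  have mem_X: "y \<in> X \<longleftrightarrow> (\<forall>i. m i \<le> \<gamma> i * y $ i \<and> \<gamma> i * y $ i \<le> M i)" if "l \<in> D" for y l
  proof -
    have "X \<noteq> {}"
      using nonempty[OF that] by (auto simp: disjunct_def)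
    then show ?thesis
      using mem_cbox_iff_scaled_bounds[of L U \<gamma> y] \<gamma> X by (simp add: m_def M_def)
  qed
  have mem_disjunct: "y \<in> disjunct X C h b l \<longleftrightarrow>
      y \<in> X \<and> (\<forall>k\<in>C l. (\<Sum>i\<in>UNIV. a i k * y $ i) \<le> b l k - (\<Sum>i\<in>UNIV. c i k))" if "l \<in> D" for y l
    using affine[OF that] by (auto simp: disjunct_def partial_sum_def sum.distrib algebra_simps)
  have hull: "convex hull (\<Union>l\<in>D. disjunct X C h b l) =
    {\<Sum>d\<in>D. lam d *\<^sub>R y d |lam y. (\<forall>d\<in>D. lam d \<ge> 0) \<and> sum lam D = 1 \<and> (\<forall>d\<in>D. y d \<in> disjunct X C h b d)}"
  proof (rule convex_hull_finite_union[OF \<open>finite D\<close>], intro ballI conjI nonempty)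
    fix l assume l: "l \<in> D"
    have "convex_on UNIV (h i k)" if "k \<in> C l" for i k
    proof (rule convex_onI)
      fix t u v :: real
      show "h i k ((1 - t) *\<^sub>R u + t *\<^sub>R v) \<le> (1 - t) * h i k u + t * h i k v"
        by (simp add: affine[OF l that] algebra_simps)
    qed simp
    then show "convex (disjunct X C h b l)"
      unfolding X by (intro convex_disjunct convex_box(1))
  qed
  show ?thesis
  proof (intro set_eqI iffI)
    fix x assume "x \<in> fst ` n_split_affine {0..1} X D C a c b \<gamma>"
    then obtain \<alpha> \<nu> lam where *: "(x, \<alpha>, \<nu>, lam) \<in> n_split_affine {0..1} X D C a c b \<gamma>"
      by auto
    then have lam: "\<forall>d\<in>D. 0 \<le> lam d" "(\<Sum>d\<in>D. lam d) = 1"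
      and x: "\<gamma> i * x $ i = (\<Sum>d\<in>D. \<nu> i d)" for i
      by (simp_all add: n_split_affine_def) metis
    have bounds: "m i * lam d \<le> \<nu> i d \<and> \<nu> i d \<le> M i * lam d" if "d \<in> D" for i d
      using * that by (simp add: n_split_affine_def m_def M_def)
    have cons: "(\<Sum>i\<in>UNIV. a i k / \<gamma> i * \<nu> i d) \<le> (b d k - (\<Sum>i\<in>UNIV. c i k)) * lam d"
      if "d \<in> D" "k \<in> C d" for d k
      using * that by (simp add: n_split_affine_def)
    define y where "y d = (if lam d = 0 then SOME z. z \<in> disjunct X C h b d
      else (\<chi> i. \<nu> i d / (\<gamma> i * lam d)))" for d
    have \<nu>_eq: "\<nu> i d = \<gamma> i * (lam d * y d $ i)" if "d \<in> D" for i d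
      using bounds[OF that, of i] \<gamma> by (cases "lam d = 0") (auto simp: y_def)
    have "y d \<in> disjunct X C h b d" if d: "d \<in> D" for d
    proof (cases "lam d = 0")
      case True
      then show ?thesis
        using nonempty[OF d] by (simp add: y_def some_in_eq)
    next
      case False
      then have pos: "lam d > 0"
        using lam(1) d by force
      have "m i \<le> \<gamma> i * y d $ i \<and> \<gamma> i * y d $ i \<le> M i" for i
      proof -
        have "m i * lam d \<le> (\<gamma> i * y d $ i) * lam d \<and> (\<gamma> i * y d $ i) * lam d \<le> M i * lam d"
          using bounds[OF d, of i] \<nu>_eq[OF d, of i] by (simp add: mult_ac)
        then show ?thesis
          using pos by simp
      qed
      moreover have "(\<Sum>i\<in>UNIV. a i k * y d $ i) \<le> b d k - (\<Sum>i\<in>UNIV. c i k)" if "k \<in> C d" for k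
      proof -
        have "(\<Sum>i\<in>UNIV. a i k / \<gamma> i * \<nu> i d) = (\<Sum>i\<in>UNIV. a i k * y d $ i) * lam d"
          using \<gamma> by (simp add: \<nu>_eq[OF d] sum_distrib_left mult_ac)
        then show ?thesis
          using cons[OF d that] pos by simp
      qed
      ultimately show ?thesis
        using mem_disjunct[OF d] mem_X[OF d] by blast
    qed
    moreover have "x = (\<Sum>d\<in>D. lam d *\<^sub>R y d)"
    proof (rule vec_eq_iff[THEN iffD2], rule allI)
      fix i
      have "\<gamma> i * x $ i = \<gamma> i * (\<Sum>d\<in>D. lam d * y d $ i)"
        using x[of i] \<nu>_eq by (simp add: sum_distrib_left)
      then show "x $ i = (\<Sum>d\<in>D. lam d *\<^sub>R y d) $ i"
        using \<gamma>[of i] by simp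
    qed
    ultimately show "x \<in> convex hull (\<Union>l\<in>D. disjunct X C h b l)"
      unfolding hull using lam by blast
  next
    fix x assume x_hull: "x \<in> convex hull (\<Union>l\<in>D. disjunct X C h b l)"
    then obtain lam y where lam: "\<forall>d\<in>D. lam d \<ge> 0" "sum lam D = 1"
      and y: "\<And>d. d \<in> D \<Longrightarrow> y d \<in> disjunct X C h b d" and x: "x = (\<Sum>d\<in>D. lam d *\<^sub>R y d)"
      unfolding hull by blast
    have "(\<Union>l\<in>D. disjunct X C h b l) \<subseteq> X"
      by (auto simp: disjunct_def)
    then have "x \<in> X"
      using x_hull hull_minimal[of _ X convex] convex_box(1) X by blast
    have lam_le: "lam d \<le> 1" if "d \<in> D" for d
      using member_le_sum[of d D lam] that lam \<open>finite D\<close> by auto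
    define \<nu> where "\<nu> i d = \<gamma> i * (lam d * y d $ i)" for i d
    have "\<gamma> i * x $ i = (\<Sum>d\<in>D. \<nu> i d)" for i
      by (simp add: x \<nu>_def sum_distrib_left)
    moreover have "m i * lam d \<le> \<nu> i d \<and> \<nu> i d \<le> M i * lam d" if d: "d \<in> D" for i d
    proof -
      have "m i \<le> \<gamma> i * y d $ i \<and> \<gamma> i * y d $ i \<le> M i"
        using y[OF d] mem_disjunct[OF d] mem_X[OF d] by blast
      then have "m i * lam d \<le> (\<gamma> i * y d $ i) * lam d \<and> (\<gamma> i * y d $ i) * lam d \<le> M i * lam d"
        using lam(1) d by (auto intro: mult_right_mono)
      then show ?thesis
        by (simp add: \<nu>_def mult_ac)
    qed
    moreover have "(\<Sum>i\<in>UNIV. a i k / \<gamma> i * \<nu> i d) \<le> (b d k - (\<Sum>i\<in>UNIV. c i k)) * lam d"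
      if d: "d \<in> D" and k: "k \<in> C d" for d k
    proof -
      have "(\<Sum>i\<in>UNIV. a i k / \<gamma> i * \<nu> i d) = (\<Sum>i\<in>UNIV. a i k * y d $ i) * lam d"
        using \<gamma> by (simp add: \<nu>_def sum_distrib_left mult_ac)
      also have "\<dots> \<le> (b d k - (\<Sum>i\<in>UNIV. c i k)) * lam d"
        using y[OF d] mem_disjunct[OF d] k lam(1) d by (intro mult_right_mono) auto
      finally show ?thesis .
    qed
    ultimately have "(x, \<chi> i. \<gamma> i * x $ i, \<nu>, lam) \<in> n_split_affine {0..1} X D C a c b \<gamma>"
      using \<open>x \<in> X\<close> lam lam_le by (simp add: n_split_affine_def m_def M_def)
    then show "x \<in> fst ` n_split_affine {0..1} X D C a c b \<gamma>"
      by force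
  qed
qed

section \<open>The hierarchy\<close>

theorem corollary3:
  fixes X :: "(real ^ 'n::finite) set"
    and L U :: "real ^ 'n"
    and D :: "'d set"
    and C :: "'d \<Rightarrow> 'k set"
    and h :: "'n \<Rightarrow> 'k \<Rightarrow> real \<Rightarrow> real"
    and b :: "'d \<Rightarrow> 'k \<Rightarrow> real"
  assumes "convex X" and "compact X"
    and "finite D" and "\<And>l. l \<in> D \<Longrightarrow> finite (C l)"
    and "\<And>l k i. l \<in> D \<Longrightarrow> k \<in> C l \<Longrightarrow> convex_on UNIV (h i k)"
    and "\<And>l k. l \<in> D \<Longrightarrow> k \<in> C l \<Longrightarrow> bounded (constraint_fun h k ` X)"
    and "\<And>l. l \<in> D \<Longrightarrow> disjunct X C h b l \<noteq> {}"
    and "additive_bounds X (\<Union>l\<in>D. C l) h"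
    and "X = cbox L U"
  shows
    "(\<forall>I. variable_partition 1 I \<longrightarrow>
        fst ` p_split {0..1} X D C h b 1 I = fst ` big_M {0..1} X D C h b) \<and>
     (\<forall>P I J. variable_partition P I \<and> variable_partition (P + 1) J \<and> splits_one_group P I J \<longrightarrow>
        fst ` p_split {0..1} X D C h b (P + 1) J \<subseteq> fst ` p_split {0..1} X D C h b P I) \<and>
     (\<forall>a c \<gamma>. (\<forall>l\<in>D. \<forall>k\<in>C l. \<forall>i t. h i k t = a i k * t + c i k) \<and> (\<forall>i. \<gamma> i \<noteq> 0) \<longrightarrow>
        fst ` n_split_affine {0..1} X D C a c b \<gamma> = convex hull (\<Union>l\<in>D. disjunct X C h b l))"
proof (intro conjI allI impI)
  fix I :: "nat \<Rightarrow> 'n set"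
  assume "variable_partition 1 I"
  then show "fst ` p_split {0..1} X D C h b 1 I = fst ` big_M {0..1} X D C h b"
    using p_split_1_eq_big_M assms(2,3,5,7) by blast
next
  fix P and I J :: "nat \<Rightarrow> 'n set"
  assume IJ: "variable_partition P I \<and> variable_partition (P + 1) J \<and> splits_one_group P I J"
  show "fst ` p_split {0..1} X D C h b (P + 1) J \<subseteq> fst ` p_split {0..1} X D C h b P I"
    by (rule p_split_refine[OF assms(8)]) (use IJ splits_one_group_refines in blast)+
next
  fix a c :: "'n \<Rightarrow> 'k \<Rightarrow> real" and \<gamma> :: "'n \<Rightarrow> real"
  assume "(\<forall>l\<in>D. \<forall>k\<in>C l. \<forall>i t. h i k t = a i k * t + c i k) \<and> (\<forall>i. \<gamma> i \<noteq> 0)"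
  then show "fst ` n_split_affine {0..1} X D C a c b \<gamma> = convex hull (\<Union>l\<in>D. disjunct X C h b l)"
    by (intro n_split_affine_eq_hull[OF assms(3,9,7)]) auto
qed

end
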